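(* Let $s\in(0,1)$ and $h>0$. Then there exist non-trivial (i.e. not identically zero) real sequences $\{u_j\}_{j\in\mathbb{Z}^2}\in\ell_s$ and $\{V_j\}_{j\in\mathbb{Z}^2}\in\ell^\infty$ such that $$(-\Delta_{\mathrm d})^s u_j=V_j u_j\ \text{ for all } j=(j_1,j_2)\in\mathbb{Z}^2\qquad\text{and}\qquad u_j=0\ \text{ for all } j=(j_1,j_2)\in\mathbb{Z}^2 \text{ with } j_1\in\{-1,0,1\}.$$
   Context: Functions on the lattice $(h\mathbb{Z})^2=\{hj:j\in\mathbb{Z}^2\}$ are identified with sequences via $u_j:=u(hj)$. The space $\ell_s$ consists of all real sequences with $\sum_{m\in\mathbb{Z}^2}\frac{|u_m|}{(1+|m|)^{2+2s}}<\infty$, and $\ell^\infty$ is the space of bounded sequences indexed by $\mathbb{Z}^2$. The fractional discrete Laplacian in dimension two is $$(-\Delta_{\mathrm d})^s u_j=\sum_{m\in\mathbb{Z}^2,\,m\ne j}(u_j-u_m)K_s^h(j-m),\qquad K_s^h(m)=\frac{1}{h^{2s}|\Gamma(-s)|}\int_0^\infty e^{-4t} I_{m_1}(2t)I_{m_2}(2t)\,\frac{dt}{t^{1+s}}\quad (m\neq 0),$$ with $K_s^h(0)=0$, where $I_k$ is the modified Bessel function of the first kind of order $k\in\mathbb{Z}$ (so $I_{-k}=I_k$). *)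

theory Defs
  imports "HOL-Analysis.Analysis"
begin

(* Integer order only: for negative k the standard series, with 1/Gamma(n + k + 1) read as 0
   at the poles of Gamma, equals the one for -k, so the order enters through its absolute value. *)
definition bessel_I :: "int \<Rightarrow> real \<Rightarrow> real" where
  "bessel_I k x = (\<Sum>n. (x / 2) ^ (2 * n + nat \<bar>k\<bar>) / (fact n * fact (n + nat \<bar>k\<bar>)))"

(* Euclidean length: the norm is that of the product type, sqrt (m1^2 + m2^2). *)
definition lattice_norm :: "int \<times> int \<Rightarrow> real" where
  "lattice_norm m = norm (real_of_int (fst m), real_of_int (snd m))"

definition ell_s :: "real \<Rightarrow> (int \<times> int \<Rightarrow> real) set" where
  "ell_s s = {u. (\<lambda>m. \<bar>u m\<bar> / (1 + lattice_norm m) powr (2 + 2 * s)) summable_on UNIV}"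

definition ell_infinity :: "(int \<times> int \<Rightarrow> real) set" where
  "ell_infinity = {V. bounded (range V)}"

(* For 0 < s < 1 and m \<noteq> 0 the integrand is nonnegative and integrable: it is
   O(t powr (-s)) at 0 and O(t powr (-2 - s)) at infinity. *)
definition frac_kernel :: "real \<Rightarrow> real \<Rightarrow> int \<times> int \<Rightarrow> real" where
  "frac_kernel s h m =
     (if m = 0 then 0
      else 1 / (h powr (2 * s) * \<bar>Gamma (- s)\<bar>) *
        (LBINT t:{0<..}. exp (- 4 * t) * bessel_I (fst m) (2 * t) * bessel_I (snd m) (2 * t)
                           / t powr (1 + s)))"

(* A function on the lattice of mesh h is identified with the sequence of its values, so h enters
   only through the kernel. The sum is unordered, and absolutely convergent for u in ell_s s. *)
definition frac_discrete_laplacian ::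
    "real \<Rightarrow> real \<Rightarrow> (int \<times> int \<Rightarrow> real) \<Rightarrow> int \<times> int \<Rightarrow> real" where
  "frac_discrete_laplacian s h u j =
     (\<Sum>\<^sub>\<infinity>m\<in>{m. m \<noteq> j}. (u j - u m) * frac_kernel s h (j - m))"

end

theory Submission
  imports Defs
begin

text \<open>Unique continuation fails because the operator is nonlocal: that \<open>u\<close> and its fractional
  Laplacian both vanish on the strip \<open>j\<^sub>1 \<in> {-1, 0, 1}\<close> amounts to a few linear conditions on the
  infinitely many values of \<open>u\<close> off the strip. Off the strip, \<open>V\<close> is forced to be the quotient of
  the fractional Laplacian of \<open>u\<close> by \<open>u\<close>, which is bounded as soon as \<open>u\<close> is bounded and
  bounded away from zero there.

  Take \<open>u\<close> of the form \<open>u\<^sub>j = f (j\<^sub>1)\<close>. The condition on the strip then involves only the row sums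
  \<open>g k = (\<Sum>\<^sub>\<infinity>n. frac_kernel s h (k, n))\<close>: the convolution of \<open>f\<close> with \<open>g\<close> must vanish at
  \<open>-1\<close>, \<open>0\<close> and \<open>1\<close>. As \<open>g\<close> is even, an odd \<open>f\<close> reduces this to the single equation at \<open>1\<close>,
  which reads \<open>(\<Sum>\<^sub>\<infinity>i. f (i + 2) * (g (i + 1) - g (i + 3))) = 0\<close> with \<open>i\<close> running over the natural
  numbers. At least two coefficients are nonzero, so the equation has a solution with values \<open>1\<close>
  except at two places, where they are nonzero as well
  (\<open>odd_sequence_convolution_vanishes_near_0\<close>).

  About the kernel this uses only that it is even, summable (\<open>frac_kernel_summable\<close>) and
  positive off the origin (\<open>frac_kernel_pos\<close>). Both of the latter come from reading the integrand as
  the heat kernel of the lattice: it is positive and has total mass \<open>1\<close>, of which at least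
  \<open>exp (- 4 * t)\<close> sits at the origin.\<close>

section \<open>Modified Bessel functions and the lattice heat kernel\<close>

lemma has_sum_times_nonneg:
  fixes f :: "'a \<Rightarrow> real" and g :: "'b \<Rightarrow> real"
  assumes f: "(f has_sum a) A" and g: "(g has_sum b) B"
    and f0: "\<And>x. x \<in> A \<Longrightarrow> 0 \<le> f x" and g0: "\<And>y. y \<in> B \<Longrightarrow> 0 \<le> g y"
  shows "((\<lambda>p. f (fst p) * g (snd p)) has_sum (a * b)) (A \<times> B)"
proof (rule has_sum_SigmaI)
  show inner: "((\<lambda>y. f (fst (x, y)) * g (snd (x, y))) has_sum (f x * b)) B" if "x \<in> A" for x
    using has_sum_cmult_right[OF g, of "f x"] by simp
  show outer: "((\<lambda>x. f x * b) has_sum (a * b)) A"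
    by (rule has_sum_cmult_left[OF f])
  show "(\<lambda>p. f (fst p) * g (snd p)) summable_on A \<times> B"
    by (rule summable_on_SigmaI[OF inner has_sum_imp_summable[OF outer]]) (use f0 g0 in auto)
qed

lemma bessel_I_has_sum:
  assumes "x \<ge> 0"
  shows "((\<lambda>n. (x / 2) ^ (2 * n + nat \<bar>k\<bar>) / (fact n * fact (n + nat \<bar>k\<bar>))) has_sum bessel_I k x) UNIV"
proof -
  let ?f = "\<lambda>n. (x / 2) ^ (2 * n + nat \<bar>k\<bar>) / (fact n * fact (n + nat \<bar>k\<bar>)) :: real"
  let ?g = "\<lambda>n. (x / 2) ^ nat \<bar>k\<bar> * (((x / 2)\<^sup>2) ^ n / fact n)"
  have "summable ?g"
    using summable_exp[of "(x / 2)\<^sup>2"]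
    by (intro summable_mult) (simp add: field_simps)
  moreover have "norm (?f n) \<le> ?g n" for n
  proof -
    have "?f n = (x / 2) ^ nat \<bar>k\<bar> * (((x / 2)\<^sup>2) ^ n / fact n) * (1 / fact (n + nat \<bar>k\<bar>))"
      by (simp add: power_add power_mult)
    also have "\<dots> \<le> (x / 2) ^ nat \<bar>k\<bar> * (((x / 2)\<^sup>2) ^ n / fact n) * 1"
      using assms by (intro mult_left_mono) auto
    finally show ?thesis
      using assms by simp
  qed
  ultimately have "summable ?f"
    by (rule summable_comparison_test'[of ?g 0])
  then have "?f sums bessel_I k x"
    unfolding bessel_I_def by (rule summable_sums)
  then show ?thesis
    by (rule sums_nonneg_imp_has_sum) (use assms in auto)
qed

lemma bessel_I_nonneg: "x \<ge> 0 \<Longrightarrow> bessel_I k x \<ge> 0"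
  by (rule has_sum_nonneg[OF bessel_I_has_sum]) auto

lemma bessel_I_ge_first_term:
  assumes "x \<ge> 0"
  shows "(x / 2) ^ nat \<bar>k\<bar> / fact (nat \<bar>k\<bar>) \<le> bessel_I k x"
  using finite_sum_le_has_sum[OF bessel_I_has_sum[OF assms, of k], of "{0}"] assms by auto

lemma bessel_I_pos: "x > 0 \<Longrightarrow> bessel_I k x > 0"
  using bessel_I_ge_first_term[of x k] by (smt (verit) divide_pos_pos fact_gt_zero zero_less_power)

lemma bessel_I_abs_order: "\<bar>k\<bar> = \<bar>l\<bar> \<Longrightarrow> bessel_I k = bessel_I l"
  unfolding bessel_I_def by simp

lemma borel_measurable_bessel_I [measurable]: "bessel_I k \<in> borel_measurable borel"
  unfolding bessel_I_def by measurable

text \<open>The generating function of the Bessel functions at \<open>z = 1\<close>: multiply the two exponential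
  series \<open>exp (x / 2) * exp (x / 2) = exp x\<close> and collect the products of the terms of index
  \<open>a\<close> and \<open>b\<close> by their difference \<open>a - b = k\<close>; the smaller index is the summation variable of
  the series of \<open>bessel_I k\<close>.\<close>

lemma bessel_I_generating:
  assumes "x \<ge> 0"
  shows "((\<lambda>k. bessel_I k x) has_sum exp x) UNIV"
proof -
  let ?e = "\<lambda>a. (x / 2) ^ a / fact a :: real"
  let ?d = "\<lambda>p :: int \<times> nat. (snd p + nat (fst p), snd p + nat (- fst p))"
  have e: "(?e has_sum exp (x / 2)) UNIV"
    using exp_converges[of "x / 2"] assms
    by (intro sums_nonneg_imp_has_sum) (auto simp: field_simps)
  have "((\<lambda>p. ?e (fst p) * ?e (snd p)) has_sum (exp (x / 2) * exp (x / 2))) (UNIV \<times> UNIV)"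
    by (rule has_sum_times_nonneg[OF e e]) (use assms in auto)
  moreover have "bij_betw ?d UNIV UNIV"
    by (rule bij_betw_byWitness[where f' = "\<lambda>q. (int (fst q) - int (snd q), min (fst q) (snd q))"])
       (auto simp: min_def)
  ultimately have "((\<lambda>p. ?e (fst (?d p)) * ?e (snd (?d p))) has_sum exp x) (UNIV \<times> UNIV)"
    using has_sum_reindex_bij_betw[of ?d UNIV UNIV "\<lambda>p. ?e (fst p) * ?e (snd p)" "exp x"]
    by (simp flip: exp_add)
  then show ?thesis
  proof (rule has_sum_SigmaD)
    fix k :: int
    have "?e (fst (?d (k, n))) * ?e (snd (?d (k, n))) =
        (x / 2) ^ (2 * n + nat \<bar>k\<bar>) / (fact n * fact (n + nat \<bar>k\<bar>))" for n
    proof -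
      have "fst (?d (k, n)) + snd (?d (k, n)) = 2 * n + nat \<bar>k\<bar>"
        by simp
      moreover have "fact (fst (?d (k, n))) * fact (snd (?d (k, n))) =
          fact n * (fact (n + nat \<bar>k\<bar>) :: real)"
        by (cases "k \<ge> 0") simp_all
      ultimately show ?thesis
        by (metis power_add times_divide_times_eq)
    qed
    then show "((\<lambda>n. ?e (fst (?d (k, n))) * ?e (snd (?d (k, n)))) has_sum bessel_I k x) UNIV"
      using bessel_I_has_sum[OF assms, of k] by simp
  qed
qed

text \<open>The heat kernel of the two-dimensional discrete Laplacian, that is, the transition
  probability of the continuous-time simple random walk on the lattice.\<close>

definition lattice_heat_kernel :: "real \<Rightarrow> int \<times> int \<Rightarrow> real" where
  "lattice_heat_kernel t m = exp (- 4 * t) * bessel_I (fst m) (2 * t) * bessel_I (snd m) (2 * t)"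

lemma lattice_heat_kernel_nonneg: "t \<ge> 0 \<Longrightarrow> lattice_heat_kernel t m \<ge> 0"
  unfolding lattice_heat_kernel_def by (simp add: bessel_I_nonneg)

lemma lattice_heat_kernel_pos: "t > 0 \<Longrightarrow> lattice_heat_kernel t m > 0"
  unfolding lattice_heat_kernel_def by (simp add: bessel_I_pos)

lemma lattice_heat_kernel_has_sum:
  assumes "t \<ge> 0"
  shows "(lattice_heat_kernel t has_sum 1) UNIV"
proof -
  have B: "((\<lambda>k. bessel_I k (2 * t)) has_sum exp (2 * t)) UNIV"
    using assms by (intro bessel_I_generating) auto
  have "((\<lambda>m. bessel_I (fst m) (2 * t) * bessel_I (snd m) (2 * t)) has_sum
      (exp (2 * t) * exp (2 * t))) (UNIV \<times> UNIV)"
    using assms by (intro has_sum_times_nonneg[OF B B]) (auto intro: bessel_I_nonneg)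
  from has_sum_cmult_right[OF this, of "exp (- 4 * t)"] show ?thesis
    unfolding lattice_heat_kernel_def[abs_def] by (simp add: mult.assoc flip: exp_add)
qed

text \<open>The walk is still at its starting point at time \<open>t\<close> with probability at least
  \<open>exp (- 4 * t)\<close>, which leaves at most the rest for the other sites together.\<close>

lemma sum_lattice_heat_kernel_le:
  assumes "t \<ge> 0" and "finite F" and "0 \<notin> F"
  shows "(\<Sum>m\<in>F. lattice_heat_kernel t m) \<le> 1 - exp (- 4 * t)"
proof -
  have "sum (lattice_heat_kernel t) (insert 0 F) \<le> 1"
    using finite_sum_le_has_sum[OF lattice_heat_kernel_has_sum[OF assms(1)], of "insert 0 F"] assms
    by (auto intro: lattice_heat_kernel_nonneg)
  moreover have "exp (- 4 * t) \<le> lattice_heat_kernel t 0"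
  proof -
    have "1 \<le> bessel_I 0 (2 * t)"
      using bessel_I_ge_first_term[of "2 * t" 0] assms by simp
    then have "1 * 1 \<le> bessel_I 0 (2 * t) * bessel_I 0 (2 * t)"
      by (intro mult_mono) auto
    then show ?thesis
      unfolding lattice_heat_kernel_def by (simp add: mult.assoc)
  qed
  ultimately show ?thesis
    using assms by simp
qed

section \<open>The kernel of the fractional Laplacian\<close>

lemma set_integrable_fractional_weight:
  assumes "0 < s" and "s < 1"
  shows "set_integrable lborel {0<..} (\<lambda>t :: real. (1 - exp (- 4 * t)) / t powr (1 + s))"
proof -
  have cut: "set_integrable lborel A f"
    if "f integrable_on A" "\<And>x. x \<in> A \<Longrightarrow> f x \<ge> 0" "A \<in> sets borel" "f \<in> borel_measurable borel"
    for A :: "real set" and f :: "real \<Rightarrow> real"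
  proof -
    have "(\<lambda>x. indicator A x *\<^sub>R f x) \<in> borel_measurable lborel"
      using that(3,4) by measurable
    from integrable_completion[OF this] show ?thesis
      using nonnegative_absolutely_integrable_1[OF that(1,2)] unfolding set_integrable_def by blast
  qed
  have small: "set_integrable lborel {0<..1} (\<lambda>t :: real. (1 - exp (- 4 * t)) / t powr (1 + s))"
  proof (rule set_integrable_bound)
    show "set_integrable lborel {0<..1} (\<lambda>t :: real. 4 * t powr (- s))"
    proof -
      have "set_integrable lborel {0..1} (\<lambda>t :: real. t powr (- s))"
        by (rule cut, rule integrable_on_powr_from_0) (use assms in auto)
      then have "set_integrable lborel {0<..1} (\<lambda>t :: real. t powr (- s))"
        by (rule set_integrable_subset) auto
      then show ?thesis
        by (intro set_integrable_mult_right)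
    qed
    show "AE t in lborel. t \<in> {0<..1} \<longrightarrow>
        norm ((1 - exp (- 4 * t)) / t powr (1 + s)) \<le> norm (4 * t powr (- s))"
    proof (intro AE_I2 impI)
      fix t :: real
      assume t: "t \<in> {0<..1}"
      have "1 - exp (- 4 * t) \<le> 4 * t"
        using exp_ge_add_one_self[of "- 4 * t"] by simp
      then have "(1 - exp (- 4 * t)) / t powr (1 + s) \<le> 4 * t / t powr (1 + s)"
        by (intro divide_right_mono) auto
      also have "\<dots> = 4 * t powr (- s)"
        using t by (simp add: powr_add powr_minus field_simps)
      finally show "norm ((1 - exp (- 4 * t)) / t powr (1 + s)) \<le> norm (4 * t powr (- s))"
        using t by simp
    qed
  qed (simp add: set_borel_measurable_def)
  have large: "set_integrable lborel {1..} (\<lambda>t :: real. (1 - exp (- 4 * t)) / t powr (1 + s))"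
  proof (rule set_integrable_bound)
    show "set_integrable lborel {1..} (\<lambda>t :: real. t powr (- 1 - s))"
      using has_integral_powr_to_inf[of "- 1 - s" 1] assms
      by (intro cut) (auto simp: integrable_on_def)
    show "AE t in lborel. t \<in> {1..} \<longrightarrow>
        norm ((1 - exp (- 4 * t)) / t powr (1 + s)) \<le> norm (t powr (- 1 - s))"
    proof (intro AE_I2 impI)
      fix t :: real
      assume t: "t \<in> {1..}"
      have "(1 - exp (- 4 * t)) / t powr (1 + s) \<le> 1 / t powr (1 + s)"
        by (intro divide_right_mono) auto
      also have "\<dots> = t powr (- 1 - s)"
        using powr_minus_divide[of t "1 + s"] by simp
      finally show "norm ((1 - exp (- 4 * t)) / t powr (1 + s)) \<le> norm (t powr (- 1 - s))"
        using t by simp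
    qed
  qed (simp add: set_borel_measurable_def)
  have "{0<..} = {0<..1} \<union> {1 :: real..}"
    by auto
  then show ?thesis
    using set_integrable_Un[OF small large] by simp
qed

lemma frac_kernel_conv_heat_kernel:
  "m \<noteq> 0 \<Longrightarrow> frac_kernel s h m =
    1 / (h powr (2 * s) * \<bar>Gamma (- s)\<bar>) *
      (LBINT t:{0<..}. lattice_heat_kernel t m / t powr (1 + s))"
  unfolding frac_kernel_def lattice_heat_kernel_def by simp

lemma set_integrable_heat_kernel_weighted:
  assumes "0 < s" and "s < 1" and "m \<noteq> 0"
  shows "set_integrable lborel {0<..} (\<lambda>t. lattice_heat_kernel t m / t powr (1 + s))"
proof (rule set_integrable_bound[OF set_integrable_fractional_weight[OF assms(1,2)]])
  show "set_borel_measurable lborel {0<..} (\<lambda>t. lattice_heat_kernel t m / t powr (1 + s))"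
    unfolding set_borel_measurable_def lattice_heat_kernel_def by measurable
  show "AE t in lborel. t \<in> {0<..} \<longrightarrow> norm (lattice_heat_kernel t m / t powr (1 + s))
      \<le> norm ((1 - exp (- 4 * t)) / t powr (1 + s))"
  proof (intro AE_I2 impI)
    fix t :: real
    assume t: "t \<in> {0<..}"
    have "lattice_heat_kernel t m \<le> 1 - exp (- 4 * t)"
      using sum_lattice_heat_kernel_le[of t "{m}"] t assms by simp
    then show "norm (lattice_heat_kernel t m / t powr (1 + s))
        \<le> norm ((1 - exp (- 4 * t)) / t powr (1 + s))"
      using t lattice_heat_kernel_nonneg[of t m] by (auto intro: divide_right_mono)
  qed
qed

lemma frac_kernel_zero: "frac_kernel s h 0 = 0"
  unfolding frac_kernel_def by simp

lemma frac_kernel_nonneg: "frac_kernel s h m \<ge> 0"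
proof (cases "m = 0")
  case False
  have "(LBINT t:{0<..}. lattice_heat_kernel t m / t powr (1 + s)) \<ge> 0"
    unfolding set_lebesgue_integral_def
    by (rule integral_nonneg_AE) (auto simp: indicator_def lattice_heat_kernel_nonneg)
  then show ?thesis
    using False by (simp add: frac_kernel_conv_heat_kernel)
qed (simp add: frac_kernel_zero)

lemma frac_kernel_pos:
  assumes "0 < s" and "s < 1" and "h > 0" and "m \<noteq> 0"
  shows "frac_kernel s h m > 0"
proof -
  let ?f = "\<lambda>t. indicator {0<..} t *\<^sub>R (lattice_heat_kernel t m / t powr (1 + s)) :: real"
  have f0: "?f t \<ge> 0" for t
    by (auto simp: indicator_def lattice_heat_kernel_nonneg)
  have int: "integrable lborel ?f"
    using set_integrable_heat_kernel_weighted[OF assms(1,2,4)] by (simp add: set_integrable_def)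
  have "\<not> (AE t in lborel. ?f t = 0)"
  proof
    assume "AE t in lborel. ?f t = 0"
    then have "AE t in lborel. t \<notin> {0 :: real<..}"
    proof eventually_elim
      case (elim t)
      then show ?case
        using lattice_heat_kernel_pos[of t m] by (auto simp: indicator_def)
    qed
    then have "emeasure lborel {0 :: real<..} = 0"
      by (subst (asm) AE_iff_measurable[of "{0<..}"]) auto
    moreover have "emeasure lborel {0 :: real<..1} \<le> emeasure lborel {0 :: real<..}"
      by (rule emeasure_mono) auto
    ultimately show False
      by simp
  qed
  then have "integral\<^sup>L lborel ?f \<noteq> 0"
    using integral_nonneg_eq_0_iff_AE[OF int] f0 by simp
  moreover have "integral\<^sup>L lborel ?f \<ge> 0"
    using f0 by (intro integral_nonneg_AE) auto
  ultimately have "(LBINT t:{0<..}. lattice_heat_kernel t m / t powr (1 + s)) > 0"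
    unfolding set_lebesgue_integral_def by linarith
  moreover have "Gamma (- s) \<noteq> 0"
  proof -
    have "- s \<notin> \<int>"
    proof
      assume "- s \<in> \<int>"
      then obtain i where "- s = of_int i"
        by (rule Ints_cases)
      with assms have "of_int (- 1) < real_of_int i" and "real_of_int i < of_int 0"
        by simp_all
      then show False
        unfolding of_int_less_iff by linarith
    qed
    then show ?thesis
      using nonpos_Ints_Int by (auto simp: Gamma_eq_zero_iff)
  qed
  ultimately show ?thesis
    using assms by (simp add: frac_kernel_conv_heat_kernel)
qed

lemma frac_kernel_reflect: "frac_kernel s h (- k, n) = frac_kernel s h (k, n)"
  unfolding frac_kernel_def
  by (simp add: zero_prod_def bessel_I_abs_order[of "- k" k])

text \<open>Summed over the sites other than the origin, the heat kernel is at most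
  \<open>1 - exp (- 4 * t)\<close>. This is \<open>O(t)\<close> at \<open>0\<close> and bounded at infinity, hence integrable against
  \<open>t powr (- 1 - s)\<close>, and the integral bounds every finite sum of the kernel.\<close>

lemma frac_kernel_summable:
  assumes "0 < s" and "s < 1"
  shows "frac_kernel s h summable_on UNIV"
proof (rule nonneg_bdd_above_summable_on)
  let ?C = "1 / (h powr (2 * s) * \<bar>Gamma (- s)\<bar>)"
  let ?B = "LBINT t:{0<..}. (1 - exp (- 4 * t)) / t powr (1 + s)"
  show "bdd_above (sum (frac_kernel s h) ` {F. F \<subseteq> UNIV \<and> finite F})"
  proof (rule bdd_aboveI2)
    fix F :: "(int \<times> int) set"
    assume "F \<in> {F. F \<subseteq> UNIV \<and> finite F}"
    then have fin: "finite F"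
      by simp
    define G where "G = F - {0}"
    have G: "finite G" "0 \<notin> G"
      using fin by (auto simp: G_def)
    let ?f = "\<lambda>m t. lattice_heat_kernel t m / t powr (1 + s)"
    have int: "set_integrable lborel {0<..} (?f m)" if "m \<in> G" for m
      by (rule set_integrable_heat_kernel_weighted) (use assms G that in auto)
    have "sum (frac_kernel s h) F = sum (frac_kernel s h) G"
      unfolding G_def by (rule sum.mono_neutral_right) (use fin frac_kernel_zero in auto)
    also have "\<dots> = (\<Sum>m\<in>G. ?C * (LBINT t:{0<..}. ?f m t))"
      using G by (intro sum.cong frac_kernel_conv_heat_kernel) auto
    also have "\<dots> = ?C * (\<Sum>m\<in>G. LBINT t:{0<..}. ?f m t)"
      by (rule sum_distrib_left[symmetric])
    also have "(\<Sum>m\<in>G. LBINT t:{0<..}. ?f m t) = (LBINT t:{0<..}. (\<Sum>m\<in>G. ?f m t))"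
      using int unfolding set_lebesgue_integral_def set_integrable_def scaleR_sum_right
      by (intro Bochner_Integration.integral_sum[symmetric])
    also have "(LBINT t:{0<..}. (\<Sum>m\<in>G. ?f m t)) \<le> ?B"
    proof (rule set_integral_mono)
      show "set_integrable lborel {0<..} (\<lambda>t. \<Sum>m\<in>G. ?f m t)"
        using int unfolding set_integrable_def scaleR_sum_right
        by (intro Bochner_Integration.integrable_sum)
      show "(\<Sum>m\<in>G. ?f m t) \<le> (1 - exp (- 4 * t)) / t powr (1 + s)" if "t \<in> {0<..}" for t
        using sum_lattice_heat_kernel_le[of t G] G that
        by (auto simp flip: sum_divide_distrib intro: divide_right_mono)
    qed (rule set_integrable_fractional_weight[OF assms])
    finally show "sum (frac_kernel s h) F \<le> ?C * ?B"
      by (simp add: mult_left_mono divide_right_mono)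
  qed
qed (rule frac_kernel_nonneg)

section \<open>Sequences whose convolution vanishes near the origin\<close>

lemma summable_on_bounded_mult:
  fixes K c :: "'a \<Rightarrow> real"
  assumes K: "K summable_on A" and c: "\<And>x. \<bar>c x\<bar> \<le> M"
  shows "(\<lambda>x. c x * K x) summable_on A"
proof -
  have "(\<lambda>x. norm (K x)) summable_on A"
    using K by (rule iffD1[OF summable_on_iff_abs_summable_on_real])
  then have "(\<lambda>x. M * norm (K x)) summable_on A"
    by (rule summable_on_cmult_right)
  moreover have "norm (c x * K x) \<le> M * norm (K x)" for x
    using c[of x] by (simp add: abs_mult mult_right_mono)
  ultimately have "(\<lambda>x. norm (c x * K x)) summable_on A"
    by (rule Infinite_Sum.abs_summable_on_comparison_test')
  then show ?thesis
    by (rule abs_summable_summable)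
qed

text \<open>A linear condition with two nonzero coefficients still leaves a line of values for
  the corresponding two entries when all others are \<open>1\<close>, and a generic point of this line has
  both entries nonzero.\<close>

lemma annihilated_by_nowhere_zero_sequence:
  fixes a :: "'a \<Rightarrow> real"
  assumes summ: "a summable_on UNIV" and ne: "a p \<noteq> 0" "a q \<noteq> 0" "p \<noteq> q"
  shows "\<exists>(b :: 'a \<Rightarrow> real) M \<delta>. (\<forall>i. \<bar>b i\<bar> \<le> M) \<and> \<delta> > 0 \<and> (\<forall>i. \<delta> \<le> \<bar>b i\<bar>) \<and>
    ((\<lambda>i. b i * a i) has_sum 0) UNIV"
proof -
  define T where "T = infsum a (- {p, q})"
  have T: "(a has_sum T) (- {p, q})"
    unfolding T_def by (rule has_sum_infsum, rule summable_on_subset[OF summ]) auto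
  \<comment> \<open>At most one value at \<open>p\<close> forces the value at \<open>q\<close> to be \<open>0\<close>, so one of two candidates will do.\<close>
  obtain x :: real where x: "x \<in> {1, 2}" "T + x * a p \<noteq> 0"
  proof (cases "T + 1 * a p = 0")
    case True
    then have "T + 2 * a p \<noteq> 0"
      using ne by auto
    then show ?thesis
      by (intro that[of 2]) auto
  next
    case False
    then show ?thesis
      by (intro that[of 1]) auto
  qed
  define y where "y = - (T + x * a p) / a q"
  have y: "y \<noteq> 0" "T + x * a p + y * a q = 0"
    using x ne by (auto simp: y_def)
  define b where "b = (\<lambda>i. if i = p then x else if i = q then y else 1)"
  have "((\<lambda>i. b i * a i) has_sum T) (- {p, q}) \<longleftrightarrow> (a has_sum T) (- {p, q})"
    by (rule has_sum_cong) (auto simp: b_def)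
  then have "((\<lambda>i. b i * a i) has_sum T) (- {p, q})"
    using T by simp
  moreover have "((\<lambda>i. b i * a i) has_sum (x * a p + y * a q)) {p, q}"
    by (rule has_sum_finiteI) (use ne in \<open>auto simp: b_def\<close>)
  ultimately have "((\<lambda>i. b i * a i) has_sum (T + (x * a p + y * a q))) (- {p, q} \<union> {p, q})"
    by (rule has_sum_Un_disjoint) auto
  moreover have "- {p, q} \<union> {p, q} = UNIV"
    by blast
  ultimately have "((\<lambda>i. b i * a i) has_sum 0) UNIV"
    using y by (simp only: add.assoc)
  then show ?thesis
    by (intro exI[of _ b] exI[of _ "2 + \<bar>y\<bar>"] exI[of _ "min 1 \<bar>y\<bar>"])
       (use x y in \<open>auto simp: b_def\<close>)
qed

text \<open>For an even kernel \<open>g\<close>, convolution with an odd sequence \<open>f\<close> gives an odd sequence, which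
  vanishes on \<open>{-1, 0, 1}\<close> as soon as it vanishes at \<open>1\<close>. If \<open>f\<close> is zero on \<open>{-1, 0, 1}\<close>, this is
  a single linear condition on the values \<open>f (i + 2)\<close>, with the coefficients
  \<open>g (i + 1) - g (i + 3)\<close>. Along each parity class these differences of \<open>g\<close> cannot all vanish,
  since \<open>g\<close> is positive at \<open>1\<close> and at \<open>2\<close> and tends to \<open>0\<close>.\<close>

lemma odd_sequence_convolution_vanishes_near_0:
  fixes g :: "int \<Rightarrow> real"
  assumes summ: "g summable_on UNIV" and even: "\<And>k. g (- k) = g k"
    and pos: "g 1 > 0" "g 2 > 0"
  shows "\<exists>(f :: int \<Rightarrow> real) M \<delta>. (\<forall>k. \<bar>f k\<bar> \<le> M) \<and> \<delta> > 0 \<and>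
    (\<forall>k. k \<notin> {-1, 0, 1} \<longrightarrow> \<delta> \<le> \<bar>f k\<bar>) \<and> (\<forall>k\<in>{-1, 0, 1}. f k = 0) \<and>
    (\<forall>j\<in>{-1, 0, 1}. ((\<lambda>k. f (j - k) * g k) has_sum 0) UNIV)"
proof -
  define a where "a = (\<lambda>i :: nat. g (int i + 1) - g (int i + 3))"
  have shift: "(\<lambda>i :: nat. g (int i + c)) summable_on UNIV" for c
  proof -
    have "g summable_on (\<lambda>i. int i + c) ` UNIV"
      by (rule summable_on_subset[OF summ]) auto
    then show ?thesis
      by (subst (asm) summable_on_reindex) (auto simp: inj_on_def o_def)
  qed
  have a: "a summable_on UNIV"
    unfolding a_def diff_conv_add_uminus
    by (intro summable_on_add shift) (simp only: summable_on_uminus shift)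
  have differs: "\<exists>i. a (2 * i + r) \<noteq> 0" if "g (int r + 1) > 0" for r
  proof (rule ccontr)
    assume "\<not> ?thesis"
    then have step: "g (int (2 * i + r) + 3) = g (int (2 * i + r) + 1)" for i
      by (auto simp: a_def)
    have const: "g (int (2 * i + r) + 1) = g (int r + 1)" for i
    proof (induction i)
      case (Suc i)
      have "int (2 * Suc i + r) + 1 = int (2 * i + r) + 3"
        by simp
      then show ?case
        using step[of i] Suc.IH by metis
    qed simp
    have "(\<lambda>n. g (int n + 1)) \<longlonglongrightarrow> 0"
      using has_sum_imp_sums[OF has_sum_infsum[OF shift[of 1]]]
      by (intro summable_LIMSEQ_zero) (auto simp: sums_iff)
    moreover have "strict_mono (\<lambda>i :: nat. 2 * i + r)"
      by (auto simp: strict_mono_def)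
    ultimately have "((\<lambda>n. g (int n + 1)) \<circ> (\<lambda>i. 2 * i + r)) \<longlonglongrightarrow> 0"
      by (rule LIMSEQ_subseq_LIMSEQ)
    then have "(\<lambda>i :: nat. g (int r + 1)) \<longlonglongrightarrow> 0"
      using const by (simp add: o_def)
    then show False
      using that by (simp add: LIMSEQ_const_iff)
  qed
  obtain i i' where ne: "a (2 * i + 0) \<noteq> 0" "a (2 * i' + 1) \<noteq> 0"
    using differs[of 0] differs[of 1] pos by auto
  have "2 * i + 0 \<noteq> 2 * i' + 1"
    by presburger
  then obtain b M \<delta> where b: "\<And>i. \<bar>b i\<bar> \<le> M" "\<delta> > 0" "\<And>i. \<delta> \<le> \<bar>b i\<bar>"
    and b_sum: "((\<lambda>i. b i * a i) has_sum 0) UNIV"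
    using annihilated_by_nowhere_zero_sequence[OF a ne] by blast
  define f where
    "f = (\<lambda>k :: int. if k \<ge> 2 then b (nat (k - 2)) else if k \<le> - 2 then - b (nat (- k - 2)) else 0)"
  have odd: "f (- k) = - f k" for k
    by (auto simp: f_def)
  have f_le: "\<bar>f k\<bar> \<le> M" for k
    using b(1) order_trans[OF abs_ge_zero b(1)] by (auto simp: f_def)
  have f_strip: "f k = 0" if "k \<in> {-1, 0, 1}" for k
    using that by (auto simp: f_def)
  have summ_fg: "(\<lambda>k. f (j - k) * g k) summable_on UNIV" for j
    by (rule summable_on_bounded_mult[OF summ f_le])
  have reflect: "((\<lambda>k. f (- j - k) * g k) has_sum - S) UNIV"
    if "((\<lambda>k. f (j - k) * g k) has_sum S) UNIV" for j S
  proof -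
    have "((\<lambda>k. f (- j - k) * g k) has_sum - S) UNIV \<longleftrightarrow>
        ((\<lambda>k. - (f (j - k) * g k)) has_sum - S) UNIV"
    proof (rule has_sum_reindex_bij_witness[of _ uminus uminus])
      show "- (f (j - - k) * g (- k)) = f (- j - k) * g k" for k
        using odd[of "j + k"] even[of k] by simp
    qed auto
    then show ?thesis
      using that by (simp add: has_sum_uminus)
  qed
  have at_0: "((\<lambda>k. f (0 - k) * g k) has_sum 0) UNIV"
  proof -
    have S: "((\<lambda>k. f (0 - k) * g k) has_sum infsum (\<lambda>k. f (0 - k) * g k) UNIV) UNIV"
      by (rule has_sum_infsum[OF summ_fg])
    have "((\<lambda>k. f (0 - k) * g k) has_sum - infsum (\<lambda>k. f (0 - k) * g k) UNIV) UNIV"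
      using reflect[of 0, OF S] by (simp only: minus_zero)
    then have "infsum (\<lambda>k. f (0 - k) * g k) UNIV = - infsum (\<lambda>k. f (0 - k) * g k) UNIV"
      by (rule has_sum_unique[OF S])
    then show ?thesis
      using S by simp
  qed
  have at_1: "((\<lambda>k. f (1 - k) * g k) has_sum 0) UNIV"
  proof -
    let ?F = "\<lambda>k. f (1 - k) * g k"
    have S: "(?F has_sum infsum ?F A) A" for A
      by (rule has_sum_infsum, rule summable_on_subset[OF summ_fg]) auto
    \<comment> \<open>The half-lines on which \<open>f (1 - k)\<close> is given by \<open>b\<close>, up to sign.\<close>
    have neg: "((\<lambda>i. b i * g (int i + 1)) has_sum infsum ?F {..- 1}) UNIV"
    proof -
      have "((\<lambda>i. b i * g (int i + 1)) has_sum infsum ?F {..- 1}) UNIV \<longleftrightarrow>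
          (?F has_sum infsum ?F {..- 1}) {..- 1}"
      proof (rule has_sum_reindex_bij_witness[of _ "\<lambda>k. nat (- k - 1)" "\<lambda>i. - int i - 1"])
        show "f (1 - (- int i - 1)) * g (- int i - 1) = b i * g (int i + 1)" for i
          using even[of "int i + 1"] by (simp add: f_def)
      qed auto
      then show ?thesis
        using S by simp
    qed
    have pos: "((\<lambda>i. - b i * g (int i + 3)) has_sum infsum ?F {3..}) UNIV"
    proof -
      have "((\<lambda>i. - b i * g (int i + 3)) has_sum infsum ?F {3..}) UNIV \<longleftrightarrow>
          (?F has_sum infsum ?F {3..}) {3..}"
        by (rule has_sum_reindex_bij_witness[of _ "\<lambda>k. nat (k - 3)" "\<lambda>i. int i + 3"])
           (auto simp: f_def)
      then show ?thesis
        using S by simp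
    qed
    have mid: "(?F has_sum 0) {0..2}"
      by (rule has_sum_0) (auto simp: f_def)
    have "((\<lambda>i. b i * a i) has_sum (infsum ?F {..- 1} + infsum ?F {3..})) UNIV"
      using has_sum_add[OF neg pos] by (simp add: a_def algebra_simps)
    then have "infsum ?F {..- 1} + infsum ?F {3..} = 0"
      using b_sum has_sum_unique by blast
    moreover have "(?F has_sum (infsum ?F {..- 1} + infsum ?F {3..} + 0)) (({..- 1} \<union> {3..}) \<union> {0..2})"
      by (intro has_sum_Un_disjoint S mid) auto
    moreover have "({..- 1} \<union> {3..}) \<union> {0..2} = (UNIV :: int set)"
      by auto
    ultimately show ?thesis
      by simp
  qed
  have "\<delta> \<le> \<bar>f k\<bar>" if "k \<notin> {-1, 0, 1}" for k
    using that b(3) by (auto simp: f_def)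
  moreover have "((\<lambda>k. f (j - k) * g k) has_sum 0) UNIV" if "j \<in> {-1, 0, 1}" for j
    using that at_0 at_1 reflect[of 1, OF at_1] by auto
  ultimately show ?thesis
    using f_le f_strip b(2) by blast
qed

text \<open>Summing over the second coordinate first reduces the convolution of a sequence that is
  constant in that coordinate to a convolution on the integers.\<close>

lemma convolution_of_first_coordinate:
  fixes K :: "int \<times> int \<Rightarrow> real"
  assumes K: "K summable_on UNIV" and f: "\<And>k. \<bar>f k\<bar> \<le> M"
    and row: "((\<lambda>k. f (fst j - k) * (\<Sum>\<^sub>\<infinity>n. K (k, n))) has_sum S) UNIV"
  shows "((\<lambda>m. f (fst m) * K (j - m)) has_sum S) UNIV"
proof -
  have "((\<lambda>m. f (fst j - fst m) * K m) has_sum S) (UNIV \<times> UNIV)"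
  proof (rule has_sum_SigmaI[OF _ row])
    show "(\<lambda>m. f (fst j - fst m) * K m) summable_on UNIV \<times> UNIV"
      by (rule summable_on_bounded_mult[of K _ "\<lambda>m. f (fst j - fst m)" M]) (use K f in auto)
  next
    fix k :: int
    have "(\<lambda>(k, n). K (k, n)) summable_on UNIV \<times> UNIV"
      using K by simp
    then have "(\<lambda>n. K (k, n)) summable_on UNIV"
      by (rule summable_on_SigmaD1) simp
    then show "((\<lambda>n. f (fst j - fst (k, n)) * K (k, n)) has_sum
        f (fst j - k) * (\<Sum>\<^sub>\<infinity>n. K (k, n))) UNIV"
      using has_sum_cmult_right[OF has_sum_infsum, of "\<lambda>n. K (k, n)" UNIV "f (fst j - k)"] by simp
  qed
  moreover have "((\<lambda>m. f (fst m) * K (j - m)) has_sum S) UNIV \<longleftrightarrow>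
      ((\<lambda>m. f (fst j - fst m) * K m) has_sum S) UNIV"
    by (rule has_sum_reindex_bij_witness[of _ "\<lambda>m. j - m" "\<lambda>m. j - m"]) auto
  ultimately show ?thesis
    by simp
qed

section \<open>Bounded functions belong to the weighted space\<close>

lemma summable_on_int_weight:
  assumes "0 < s"
  shows "(\<lambda>k :: int. (1 + \<bar>real_of_int k\<bar>) powr (- (1 + s))) summable_on UNIV"
proof -
  let ?w = "\<lambda>k :: int. (1 + \<bar>real_of_int k\<bar>) powr (- (1 + s))"
  have "summable (\<lambda>n. real (Suc n) powr (- (1 + s)))"
    using summable_real_powr_iff[of "- (1 + s)"] assms by (subst summable_Suc_iff) simp
  then have nat: "(\<lambda>n. ?w (int n)) summable_on UNIV"
    by (intro summable_nonneg_imp_summable_on) (auto simp: add.commute)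
  have "?w summable_on range int"
    using nat by (subst summable_on_reindex) (auto simp: o_def)
  moreover have "?w summable_on range (\<lambda>n. - int n)"
    using nat by (subst summable_on_reindex) (auto simp: o_def inj_on_def)
  ultimately have "?w summable_on range int \<union> range (\<lambda>n. - int n)"
    by (rule summable_on_union)
  moreover have "range int \<union> range (\<lambda>n. - int n) = UNIV"
  proof -
    have "k \<in> range int \<union> range (\<lambda>n. - int n)" for k
      by (cases k rule: int_cases2) auto
    then show ?thesis
      by blast
  qed
  ultimately show ?thesis
    by simp
qed

text \<open>Since \<open>(1 + |m|)\<^sup>2\<close> dominates \<open>(1 + |m\<^sub>1|) * (1 + |m\<^sub>2|)\<close>, the weight is bounded by a product of
  two summable weights on the integers.\<close>

lemma bounded_in_ell_s:
  assumes "0 < s" and u: "\<And>m. \<bar>u m\<bar> \<le> M"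
  shows "u \<in> ell_s s"
proof -
  let ?w = "\<lambda>k :: int. (1 + \<bar>real_of_int k\<bar>) powr (- (1 + s))"
  have w: "(?w has_sum infsum ?w UNIV) UNIV"
    by (rule has_sum_infsum[OF summable_on_int_weight[OF assms(1)]])
  have "(\<lambda>m. ?w (fst m) * ?w (snd m)) summable_on UNIV \<times> UNIV"
    by (rule has_sum_imp_summable[OF has_sum_times_nonneg[OF w w]]) auto
  then have "(\<lambda>m. M * (?w (fst m) * ?w (snd m))) summable_on UNIV"
    by (intro summable_on_cmult_right) simp
  moreover have "norm (\<bar>u m\<bar> / (1 + lattice_norm m) powr (2 + 2 * s)) \<le> M * (?w (fst m) * ?w (snd m))"
    for m
  proof -
    let ?x = "\<bar>real_of_int (fst m)\<bar>" and ?y = "\<bar>real_of_int (snd m)\<bar>" and ?r = "lattice_norm m"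
    have xr: "?x \<le> ?r" and yr: "?y \<le> ?r"
      using norm_fst_le[of "real_of_int (fst m)" "real_of_int (snd m)"]
        norm_snd_le[of "real_of_int (snd m)" "real_of_int (fst m)"]
      unfolding lattice_norm_def by auto
    have "(1 + ?x) * (1 + ?y) \<le> (1 + ?r) * (1 + ?r)"
      using xr yr by (intro mult_mono) auto
    then have "((1 + ?x) * (1 + ?y)) powr (1 + s) \<le> ((1 + ?r) * (1 + ?r)) powr (1 + s)"
      using assms by (intro powr_mono2) auto
    also have "\<dots> = (1 + ?r) powr (2 + 2 * s)"
      using powr_add[of "1 + ?r" "1 + s" "1 + s"] xr by (simp add: powr_mult)
    finally have le: "((1 + ?x) * (1 + ?y)) powr (1 + s) \<le> (1 + ?r) powr (2 + 2 * s)" .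
    have "\<bar>u m\<bar> / (1 + ?r) powr (2 + 2 * s) \<le> M / ((1 + ?x) * (1 + ?y)) powr (1 + s)"
      using u[of m] le by (intro frac_le) auto
    also have "\<dots> = M * (?w (fst m) * ?w (snd m))"
      by (simp only: powr_mult powr_minus) (simp add: field_simps)
    finally show ?thesis
      by simp
  qed
  ultimately have "(\<lambda>m. norm (\<bar>u m\<bar> / (1 + lattice_norm m) powr (2 + 2 * s))) summable_on UNIV"
    by (rule Infinite_Sum.abs_summable_on_comparison_test')
  then show ?thesis
    unfolding ell_s_def by simp
qed

section \<open>The failure of unique continuation\<close>

lemma frac_discrete_laplacian_UNIV:
  "frac_discrete_laplacian s h u j = (\<Sum>\<^sub>\<infinity>m. (u j - u m) * frac_kernel s h (j - m))"
  unfolding frac_discrete_laplacian_def by (rule infsum_cong_neutral) auto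

lemma frac_discrete_laplacian_bounded:
  assumes "0 < s" and "s < 1" and u: "\<And>m. \<bar>u m\<bar> \<le> M"
  shows "\<bar>frac_discrete_laplacian s h u j\<bar> \<le> 2 * M * infsum (frac_kernel s h) UNIV"
proof -
  let ?K = "frac_kernel s h"
  have "((\<lambda>m. ?K (j - m)) has_sum infsum ?K UNIV) UNIV \<longleftrightarrow> (?K has_sum infsum ?K UNIV) UNIV"
    by (rule has_sum_reindex_bij_witness[of _ "\<lambda>m. j - m" "\<lambda>m. j - m"]) auto
  then have "((\<lambda>m. ?K (j - m)) has_sum infsum ?K UNIV) UNIV"
    using has_sum_infsum[OF frac_kernel_summable[OF assms(1,2)]] by simp
  then have dom: "((\<lambda>m. 2 * M * ?K (j - m)) has_sum 2 * M * infsum ?K UNIV) UNIV"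
    by (rule has_sum_cmult_right)
  have "\<bar>u j - u m\<bar> \<le> 2 * M" for m
    using u[of j] u[of m] by linarith
  then have le: "norm ((u j - u m) * ?K (j - m)) \<le> 2 * M * ?K (j - m)" for m
    by (simp add: abs_mult frac_kernel_nonneg mult_right_mono)
  have summ: "(\<lambda>m. norm ((u j - u m) * ?K (j - m))) summable_on UNIV"
    using has_sum_imp_summable[OF dom] le by (rule Infinite_Sum.abs_summable_on_comparison_test')
  have "norm (\<Sum>\<^sub>\<infinity>m. (u j - u m) * ?K (j - m)) \<le> (\<Sum>\<^sub>\<infinity>m. norm ((u j - u m) * ?K (j - m)))"
    using summ by (rule norm_infsum_bound)
  also have "\<dots> \<le> (\<Sum>\<^sub>\<infinity>m. 2 * M * ?K (j - m))"
    by (rule infsum_mono[OF summ has_sum_imp_summable[OF dom] le])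
  also have "\<dots> = 2 * M * infsum ?K UNIV"
    using dom by (rule infsumI)
  finally show ?thesis
    by (simp add: frac_discrete_laplacian_UNIV)
qed

theorem proposition1p4:
  fixes s h :: real
  assumes "0 < s" and "s < 1" and "h > 0"
  shows "\<exists>u V :: int \<times> int \<Rightarrow> real.
           u \<in> ell_s s \<and> V \<in> ell_infinity \<and>
           (\<exists>j. u j \<noteq> 0) \<and> (\<exists>j. V j \<noteq> 0) \<and>
           (\<forall>j. frac_discrete_laplacian s h u j = V j * u j) \<and>
           (\<forall>j. fst j \<in> {-1, 0, 1} \<longrightarrow> u j = 0)"
proof -
  let ?K = "frac_kernel s h"
  let ?L = "frac_discrete_laplacian s h"
  define g where "g = (\<lambda>k. \<Sum>\<^sub>\<infinity>n. ?K (k, n))"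
  have K: "?K summable_on UNIV"
    by (rule frac_kernel_summable[OF assms(1,2)])
  have K_row: "(\<lambda>n. ?K (k, n)) summable_on UNIV" for k
    by (rule summable_on_SigmaD1[of _ UNIV "\<lambda>_. UNIV"]) (use K in simp_all)
  have g_summable: "g summable_on UNIV"
    unfolding g_def by (rule summable_on_SigmaD[of ?K UNIV "\<lambda>_. UNIV"]) (use K K_row in simp_all)
  have g_even: "g (- k) = g k" for k
    by (simp add: g_def frac_kernel_reflect)
  have g_pos: "g k > 0" if "k \<noteq> 0" for k
  proof -
    have "?K (k, 0) \<le> g k"
      using finite_sum_le_infsum[OF K_row[of k], of "{0}"] by (simp add: g_def frac_kernel_nonneg)
    moreover have "?K (k, 0) > 0"
      using that assms by (intro frac_kernel_pos) (auto simp: zero_prod_def)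
    ultimately show ?thesis
      by simp
  qed
  obtain f M \<delta> where f_le: "\<And>k. \<bar>f k\<bar> \<le> M" and \<delta>: "\<delta> > 0"
    and f_ge: "\<And>k. k \<notin> {-1, 0, 1} \<Longrightarrow> \<delta> \<le> \<bar>f k\<bar>"
    and f_strip: "\<And>k. k \<in> {-1, 0, 1} \<Longrightarrow> f k = 0"
    and conv: "\<And>j. j \<in> {-1, 0, 1} \<Longrightarrow> ((\<lambda>k. f (j - k) * g k) has_sum 0) UNIV"
    using odd_sequence_convolution_vanishes_near_0[OF g_summable g_even
        g_pos[OF one_neq_zero] g_pos[OF numeral_neq_zero]] by blast
  define u :: "int \<times> int \<Rightarrow> real" where "u = (\<lambda>m. f (fst m))"
  \<comment> \<open>Where \<open>u\<close> vanishes the equation does not determine \<open>V\<close>; the value \<open>1\<close> makes \<open>V\<close> nonzero.\<close>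
  define V where "V = (\<lambda>j. if fst j \<in> {-1, 0, 1} then 1 else ?L u j / u j)"
  have L_strip: "?L u j = 0" if "fst j \<in> {-1, 0, 1}" for j
  proof -
    have "((\<lambda>m. f (fst m) * ?K (j - m)) has_sum 0) UNIV"
      using convolution_of_first_coordinate[OF K f_le] conv[OF that] by (simp add: g_def)
    from has_sum_uminusI[OF this] have "((\<lambda>m. (u j - u m) * ?K (j - m)) has_sum 0) UNIV"
      using f_strip[OF that] by (simp add: u_def)
    then show ?thesis
      by (simp add: frac_discrete_laplacian_UNIV infsumI)
  qed
  have "u \<in> ell_s s"
    using assms(1) f_le by (intro bounded_in_ell_s) (auto simp: u_def)
  moreover have "V \<in> ell_infinity"
  proof -
    define B where "B = 2 * M * infsum ?K UNIV"
    have L_le: "\<bar>?L u j\<bar> \<le> B" for j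
      unfolding B_def using f_le by (intro frac_discrete_laplacian_bounded assms) (auto simp: u_def)
    have "norm (V j) \<le> max 1 (B / \<delta>)" for j
    proof (cases "fst j \<in> {-1, 0, 1}")
      case False
      have "\<bar>?L u j\<bar> / \<bar>u j\<bar> \<le> B / \<delta>"
        using L_le[of j] f_ge[OF False] \<delta> by (intro frac_le) (auto simp: u_def)
      then show ?thesis
        using False by (auto simp: V_def)
    qed (auto simp: V_def)
    then show ?thesis
      unfolding ell_infinity_def bounded_iff by blast
  qed
  moreover have "u (2, 0) \<noteq> 0" and "V 0 \<noteq> 0"
    using f_ge[of 2] \<delta> by (auto simp: u_def V_def)
  moreover have "?L u j = V j * u j" for j
  proof (cases "fst j \<in> {-1, 0, 1}")
    case True
    then show ?thesis
      using L_strip[OF True] f_strip[OF True] by (simp add: u_def)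
  next
    case False
    then have "u j \<noteq> 0"
      using f_ge[OF False] \<delta> by (auto simp: u_def)
    then show ?thesis
      using False by (simp add: V_def)
  qed
  moreover have "u j = 0" if "fst j \<in> {-1, 0, 1}" for j
    using f_strip[OF that] by (simp add: u_def)
  ultimately show ?thesis
    by blast
qed

end
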